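(* Let $m,n,t>0$ be integers with $t\le n$, and let $0\le b\le a\le n-t$ be integers. (i) The number of positive $(m,t)$-Schröder paths of height $n$ with exactly $a$ diagonal steps and exactly $b$ cornered diagonal steps is $$\left(\frac{t+a}{n}-\frac{m(a-b)}{mn-b-1}\right)\binom{mn-b-1}{a-b}\binom{mn+n-t-a-1}{n-t-a}.$$ (ii) The number of $m$-divisible positive $(m,t)$-Schröder paths of height $n$ with exactly $a$ diagonal steps and exactly $b$ cornered diagonal steps is $$\left(\frac{t+a}{n}-\frac{a-b}{n-b-1}\right)\binom{n-b-1}{a-b}\binom{mn+n-t-a-1}{n-t-a}.$$ Here the fractions $\frac{m(a-b)}{mn-b-1}$ and $\frac{a-b}{n-b-1}$ are read as $0$ when $a=b$ (also if the denominator vanishes).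
   Context: An $(m,t)$-Schröder path of height $n$ is a lattice path from $(0,0)$ to $(mn,n)$ using only steps $N=(0,1)$ (north), $E=(1,0)$ (east) or $D=(1,1)$ (diagonal), which starts with at least $t$ north steps and never goes below the line $x=my$ (every lattice point $(p,q)$ visited satisfies $p\le mq$). It is positive if it never touches the line $x=my$ except in $(0,0)$ and $(mn,n)$. It is $m$-divisible if every diagonal step ends at a point whose $x$-coordinate is divisible by $m$. A diagonal step is cornered if it connects $(im-1,i)$ and $(im,i+1)$ for some $i$ (with $1\le i\le n$). *)

theory Defs
  imports Complex_Main
begin

datatype step = N | E | D

type_synonym path = "step list"

primrec step_vec :: "step \<Rightarrow> nat \<times> nat" where
  "step_vec N = (0, 1)"
| "step_vec E = (1, 0)"
| "step_vec D = (1, 1)"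

(* The lattice point (x, y) reached from the origin after the first k steps. *)
definition vertex :: "path \<Rightarrow> nat \<Rightarrow> nat \<times> nat" where
  "vertex w k =
    ((\<Sum>i<k. fst (step_vec (w ! i))), (\<Sum>i<k. snd (step_vec (w ! i))))"

definition schroeder_path :: "nat \<Rightarrow> nat \<Rightarrow> nat \<Rightarrow> path \<Rightarrow> bool" where
  "schroeder_path m t n w \<longleftrightarrow>
     vertex w (length w) = (m * n, n) \<and>
     t \<le> length w \<and> (\<forall>i<t. w ! i = N) \<and>
     (\<forall>k\<le>length w. fst (vertex w k) \<le> m * snd (vertex w k))"

(* Touching the line x = m y is tested at the visited lattice points only.  On a step
   between two points with x \<le> m y, the line is met at an interior point only if the step
   runs along it, hence only for m = 1 and a D step between two points of the line.  For a
   path satisfying this predicate that forces n = 1 and first step D, excluded by t > 0. *)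
definition positive :: "nat \<Rightarrow> nat \<Rightarrow> path \<Rightarrow> bool" where
  "positive m n w \<longleftrightarrow>
     (\<forall>k\<le>length w. fst (vertex w k) = m * snd (vertex w k) \<longrightarrow>
        vertex w k \<in> {(0, 0), (m * n, n)})"

definition m_divisible :: "nat \<Rightarrow> path \<Rightarrow> bool" where
  "m_divisible m w \<longleftrightarrow>
     (\<forall>k<length w. w ! k = D \<longrightarrow> m dvd fst (vertex w (Suc k)))"

definition diagonal_steps :: "path \<Rightarrow> nat set" where
  "diagonal_steps w = {k. k < length w \<and> w ! k = D}"

(* For m > 0 the subtraction i * m - 1 does not truncate, as i \<ge> 1. *)
definition cornered_steps :: "nat \<Rightarrow> nat \<Rightarrow> path \<Rightarrow> nat set" where
  "cornered_steps m n w =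
     {k \<in> diagonal_steps w. \<exists>i\<in>{1..n}.
        vertex w k = (i * m - 1, i) \<and> vertex w (Suc k) = (i * m, i + 1)}"

definition positive_paths :: "nat \<Rightarrow> nat \<Rightarrow> nat \<Rightarrow> nat \<Rightarrow> nat \<Rightarrow> path set" where
  "positive_paths m t n a b =
     {w. schroeder_path m t n w \<and> positive m n w \<and>
         card (diagonal_steps w) = a \<and> card (cornered_steps m n w) = b}"

lemma finite_positive_paths: "finite (positive_paths m t n a b)"
proof -
  have le: "length w \<le> m * n + n" if "vertex w (length w) = (m * n, n)" for w
  proof -
    have "1 \<le> fst (step_vec s) + snd (step_vec s)" for s
      by (cases s) auto
    then have "(\<Sum>i<length w. 1) \<le>
        (\<Sum>i<length w. fst (step_vec (w ! i)) + snd (step_vec (w ! i)))"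
      by (intro sum_mono)
    with that show ?thesis
      by (simp add: vertex_def sum.distrib)
  qed
  have "s \<in> {N, E, D}" for s
    by (cases s) auto
  with le have "positive_paths m t n a b \<subseteq>
      {w. set w \<subseteq> {N, E, D} \<and> length w \<le> m * n + n}"
    unfolding positive_paths_def schroeder_path_def by blast
  moreover have "finite {w. set w \<subseteq> {N, E, D} \<and> length w \<le> m * n + n}"
    by (rule finite_lists_length_le) simp
  ultimately show ?thesis
    by (rule finite_subset)
qed

end

theory Submission
  imports Defs
begin

text \<open>
  Follow the level \<open>m y - x\<close> along the path. After the initial \<open>t\<close> north steps it is \<open>m t\<close>, and
  then N, E and D change it by \<open>m\<close>, \<open>-1\<close> and \<open>m - 1\<close>; positivity says that the level
  first reaches 0 at the very end, and the cornered steps are the D steps that start at level 1.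
  The number of such descents from an arbitrary level has a closed form, which is verified by
  splitting off the first step. The two parts of the theorem differ only in the levels at which D
  is allowed (all levels, respectively those congruent to 1 modulo \<open>m\<close>), so both are instances
  of one count in which D is allowed on a set of levels of period \<open>m\<close>.
\<close>

section \<open>Levels and descents\<close>

definition move :: "nat \<Rightarrow> nat \<Rightarrow> step \<Rightarrow> nat" where
  "move m h s = h + m * snd (step_vec s) - fst (step_vec s)"

text \<open>Natural subtraction can truncate only at level 0, where \<open>descends\<close> admits
  no further step.\<close>

lemma move_simps [simp]:
  "move m h N = h + m" "move m h E = h - 1" "move m h D = h + m - 1"
  by (simp_all add: move_def)

text \<open>\<open>Q\<close> is tested on the level before a D step minus one, so that \<open>(dvd) m\<close> expresses
  \<open>m\<close>-divisibility.\<close>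

primrec descends :: "(nat \<Rightarrow> bool) \<Rightarrow> nat \<Rightarrow> nat \<Rightarrow> path \<Rightarrow> bool" where
  "descends Q m h [] \<longleftrightarrow> h = 0"
| "descends Q m h (s # w) \<longleftrightarrow>
     0 < h \<and> (s = D \<longrightarrow> Q (h - 1)) \<and> descends Q m (move m h s) w"

primrec corners :: "nat \<Rightarrow> nat \<Rightarrow> path \<Rightarrow> nat" where
  "corners m h [] = 0"
| "corners m h (s # w) = of_bool (s = D \<and> h = 1) + corners m (move m h s) w"

definition descents ::
    "(nat \<Rightarrow> bool) \<Rightarrow> nat \<Rightarrow> nat \<Rightarrow> nat \<Rightarrow> nat \<Rightarrow> nat \<Rightarrow> path set" where
  "descents Q m h p a b =
     {w. descends Q m h w \<and> count_list w N = p \<and> count_list w D = a \<and> corners m h w = b}"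

section \<open>Vertices of a path and their levels\<close>

lemma step_vec_pos: "1 \<le> fst (step_vec s) + snd (step_vec s)"
  by (cases s) auto

lemma vertex_0 [simp]: "vertex w 0 = (0, 0)"
  by (simp add: vertex_def)

lemma vertex_Cons_Suc:
  "vertex (s # w) (Suc k) =
     (fst (step_vec s) + fst (vertex w k), snd (step_vec s) + snd (vertex w k))"
  unfolding vertex_def by (simp add: sum.lessThan_Suc_shift del: sum.lessThan_Suc)

lemma snd_vertex_length: "snd (vertex w (length w)) = count_list w N + count_list w D"
proof (induction w)
  case (Cons s w)
  then show ?case by (cases s) (auto simp: vertex_Cons_Suc)
qed simp

lemma vertex_gap:
  assumes "k \<le> l"
  shows "snd (vertex w k) \<le> snd (vertex w l)"
    "fst (vertex w k) + snd (vertex w k) + (l - k) \<le> fst (vertex w l) + snd (vertex w l)"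
proof -
  have "snd (vertex w k) \<le> snd (vertex w l) \<and>
      fst (vertex w k) + snd (vertex w k) + (l - k) \<le> fst (vertex w l) + snd (vertex w l)"
    using assms
  proof (induction rule: dec_induct)
    case (step q)
    then show ?case
      using step_vec_pos[of "w ! q"] by (simp add: vertex_def Suc_diff_le)
  qed simp
  then show "snd (vertex w k) \<le> snd (vertex w l)"
    "fst (vertex w k) + snd (vertex w k) + (l - k) \<le> fst (vertex w l) + snd (vertex w l)"
    by auto
qed

text \<open>Peels the first step off a comparison of levels. The additive form avoids truncated
  subtraction, and \<open>0 < h\<close> makes \<open>move\<close> exact.\<close>

lemma move_add:
  assumes "0 < h"
  shows "fst (step_vec s) + x < h + m * (snd (step_vec s) + y) \<longleftrightarrow> x < move m h s + m * y"
    and "fst (step_vec s) + x = h + m * (snd (step_vec s) + y) \<longleftrightarrow> x = move m h s + m * y"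
    and "h + m * (snd (step_vec s) + y) - (fst (step_vec s) + x) = move m h s + m * y - x"
  using assms by (cases s; auto)+

lemma descends_iff:
  "descends Q m h w \<longleftrightarrow>
     (\<forall>k<length w. fst (vertex w k) < h + m * snd (vertex w k) \<and>
        (w ! k = D \<longrightarrow> Q (h + m * snd (vertex w k) - fst (vertex w k) - 1))) \<and>
     fst (vertex w (length w)) = h + m * snd (vertex w (length w))"
proof (induction w arbitrary: h)
  case (Cons s w)
  show ?case
  proof (cases "0 < h")
    case True
    then show ?thesis
      unfolding length_Cons All_less_Suc2
      by (simp add: Cons.IH vertex_Cons_Suc move_add[OF True] del: diff_diff_left)
  next
    case False
    then show ?thesis
      unfolding length_Cons All_less_Suc2 by simp
  qed
qed simp

lemma card_less_eq_sum: "card {k. k < n \<and> P k} = (\<Sum>k<n. of_bool (P k))" for n :: nat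
  by (simp add: sum_of_bool_eq lessThan_def Collect_conj_eq Int_commute)

lemma corners_eq_card:
  assumes "descends Q m h w"
  shows "corners m h w =
    card {k. k < length w \<and> w ! k = D \<and> fst (vertex w k) + 1 = h + m * snd (vertex w k)}"
  using assms
proof (induction w arbitrary: h)
  case (Cons s w)
  then have h: "0 < h" and IH: "corners m (move m h s) w =
    card {k. k < length w \<and> w ! k = D \<and> fst (vertex w k) + 1 = move m h s + m * snd (vertex w k)}"
    by auto
  have *: "fst (step_vec s) + x + 1 = h + m * (snd (step_vec s) + y) \<longleftrightarrow>
      x + 1 = move m h s + m * y" for x y
    using move_add(2)[OF h, of s "x + 1" m y] by (simp only: add.assoc)
  show ?case
    \<comment> \<open>Written as a sum of indicators, the cardinality splits into the first step and
      the rest.\<close>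
    unfolding corners.simps IH card_less_eq_sum length_Cons sum.lessThan_Suc_shift
    by (simp add: vertex_Cons_Suc *[simplified] eq_commute[of h])
qed simp

section \<open>Positive Schroeder paths as descents\<close>

lemma count_list_eq_card: "count_list w x = card {k. k < length w \<and> w ! k = x}"
  by (simp add: count_list_eq_length_filter length_filter_conv_card eq_commute)

lemma descends_True_and:
  "descends Q m h w \<longleftrightarrow> descends (\<lambda>_. True) m h w \<and>
     (\<forall>k<length w. w ! k = D \<longrightarrow> Q (h + m * snd (vertex w k) - fst (vertex w k) - 1))"
  unfolding descends_iff by auto

text \<open>After the first N step the level is \<open>m\<close>. The origin is never revisited, as
  y is at least 1 from then on, and the end point is not reached early, as x + y grows with every
  step. So positivity says exactly that the level stays positive until the end.\<close>

lemma positive_Cons_iff: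
  assumes "m > 0"
  shows "schroeder_path m 1 n (N # u) \<and> positive m n (N # u) \<longleftrightarrow>
    descends (\<lambda>_. True) m m u \<and> Suc (count_list u N + count_list u D) = n"
    (is "?L \<longleftrightarrow> ?R")
proof
  assume L: ?L
  let ?l = "length u"
  have end_u: "fst (vertex u ?l) = m * n" "Suc (snd (vertex u ?l)) = n"
    using L by (auto simp: schroeder_path_def vertex_Cons_Suc)
  have "fst (vertex u k) < m + m * snd (vertex u k)" if "k < ?l" for k
  proof -
    have k: "Suc k \<le> length (N # u)" using that by simp
    have "fst (vertex u k) \<le> m + m * snd (vertex u k)"
      using L k unfolding schroeder_path_def by (fastforce simp: vertex_Cons_Suc)
    moreover have "fst (vertex u k) \<noteq> m + m * snd (vertex u k)"
    proof
      assume "fst (vertex u k) = m + m * snd (vertex u k)"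
      then have "vertex (N # u) (Suc k) \<in> {(0, 0), (m * n, n)}"
        using L k unfolding positive_def by (metis (no_types) vertex_Cons_Suc fst_conv snd_conv
            step_vec.simps(1) add_0 plus_1_eq_Suc mult_Suc_right)
      then have "fst (vertex u k) = m * n" "Suc (snd (vertex u k)) = n"
        by (auto simp: vertex_Cons_Suc)
      then show False
        using vertex_gap(2)[of k ?l u] that end_u by simp
    qed
    ultimately show ?thesis by simp
  qed
  then show ?R
    using end_u by (auto simp: descends_iff snd_vertex_length)
next
  assume R: ?R
  let ?l = "length u"
  have "fst (vertex u ?l) = m * n" "Suc (snd (vertex u ?l)) = n"
    using R by (auto simp: descends_iff snd_vertex_length)
  then have v: "vertex (N # u) (Suc ?l) = (m * n, n)"
    by (simp add: vertex_Cons_Suc)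
  have less: "fst (vertex (N # u) (Suc k)) < m * snd (vertex (N # u) (Suc k))" if "k < ?l" for k
    using R that by (simp add: descends_iff vertex_Cons_Suc)
  have cases: "k = 0 \<or> (\<exists>j<?l. k = Suc j) \<or> k = Suc ?l" if "k \<le> length (N # u)" for k
    using that by (cases k) auto
  have "fst (vertex (N # u) k) \<le> m * snd (vertex (N # u) k) \<and>
      (fst (vertex (N # u) k) = m * snd (vertex (N # u) k) \<longrightarrow>
        vertex (N # u) k \<in> {(0, 0), (m * n, n)})" if "k \<le> length (N # u)" for k
    using cases[OF that] less v by (fastforce dest: less_imp_le)
  then show ?L
    using v by (simp add: schroeder_path_def positive_def)
qed

text \<open>Starting from \<open>Suc j\<close> keeps the level positive, as \<open>descends\<close>
  demands before each step.\<close>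

lemma descends_replicate:
  "m > 0 \<Longrightarrow> descends Q m (m * Suc j) (replicate i N @ v) = descends Q m (m * Suc (i + j)) v"
proof (induction i arbitrary: j)
  case (Suc i)
  show ?case
    using Suc.IH[of "Suc j"] Suc.prems by (simp add: algebra_simps)
qed simp

lemma corners_replicate: "corners m (m * j) (replicate i N @ v) = corners m (m * (i + j)) v"
proof (induction i arbitrary: j)
  case (Suc i)
  show ?case
    using Suc.IH[of "Suc j"] by (simp add: algebra_simps)
qed simp

lemma diagonal_steps_card: "card (diagonal_steps w) = count_list w D"
  by (simp add: diagonal_steps_def count_list_eq_card)

lemma cornered_steps_card:
  assumes m: "m > 0" and u: "descends Q m m u"
    and n: "Suc (count_list u N + count_list u D) = n"
  shows "card (cornered_steps m n (N # u)) = corners m m u"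
proof -
  \<comment> \<open>The bound \<open>i \<le> n\<close> in \<open>cornered_steps\<close> holds
    automatically, since y never decreases along the path.\<close>
  have le: "Suc (snd (vertex u k)) \<le> n" if "k < length u" for k
    using vertex_gap(1)[of k "length u" u] that n by (simp add: snd_vertex_length)
  have "(\<exists>i\<in>{1..n}. vertex (N # u) (Suc k) = (i * m - 1, i) \<and>
        vertex (N # u) (Suc (Suc k)) = (i * m, i + 1)) \<longleftrightarrow>
      fst (vertex u k) + 1 = m + m * snd (vertex u k)"
    if "k < length u" "u ! k = D" for k
  proof -
    have "vertex u (Suc k) = (Suc (fst (vertex u k)), Suc (snd (vertex u k)))"
      using that by (simp add: vertex_def)
    then show ?thesis
      using le[OF that(1)] m
      by (auto simp: vertex_Cons_Suc algebra_simps)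
  qed
  then have "{k. k < length u \<and> u ! k = D \<and> fst (vertex u k) + 1 = m + m * snd (vertex u k)} =
      {k. Suc k \<in> cornered_steps m n (N # u)}"
    unfolding cornered_steps_def diagonal_steps_def by auto
  moreover have "0 \<notin> cornered_steps m n (N # u)"
    by (simp add: cornered_steps_def diagonal_steps_def)
  then have "cornered_steps m n (N # u) = Suc ` {k. Suc k \<in> cornered_steps m n (N # u)}"
    by (auto simp: image_iff) (metis not0_implies_Suc)
  ultimately have "cornered_steps m n (N # u) =
      Suc ` {k. k < length u \<and> u ! k = D \<and> fst (vertex u k) + 1 = m + m * snd (vertex u k)}"
    by simp
  then show ?thesis
    using corners_eq_card[OF u] by (simp add: card_image)
qed

text \<open>A D step that leaves (x, y) at level h = m y - x ends at x + 1 = m y - (h - 1), so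
  \<open>m\<close> divides x + 1 iff it divides h - 1.\<close>

lemma m_divisible_Cons_iff:
  assumes "descends (\<lambda>_. True) m m u"
  shows "m_divisible m (N # u) \<longleftrightarrow> descends ((dvd) m) m m u"
proof -
  have "m dvd fst (vertex u (Suc k)) \<longleftrightarrow>
      m dvd (m + m * snd (vertex u k) - fst (vertex u k) - 1)"
    if "k < length u" "u ! k = D" for k
  proof -
    have "Suc (fst (vertex u k)) \<le> m + m * snd (vertex u k)"
      using assms that by (auto simp: descends_iff)
    moreover have "fst (vertex u (Suc k)) = Suc (fst (vertex u k))"
      using that by (simp add: vertex_def)
    ultimately show ?thesis
      by (metis diff_diff_left dvd_diff_nat dvd_triv_left dvd_add diff_diff_cancel dvd_refl
          Suc_eq_plus1)
  qed
  then show ?thesis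
    using assms
    unfolding m_divisible_def descends_True_and[of "(dvd) m"] length_Cons All_less_Suc2
    by (auto simp: vertex_Cons_Suc)
qed

lemma schroeder_path_replicate_iff:
  assumes "t > 0"
  shows "schroeder_path m t n w \<longleftrightarrow>
    (\<exists>v. w = replicate t N @ v) \<and> schroeder_path m 1 n w"
proof -
  have *: "(t \<le> length w \<and> (\<forall>i<t. w ! i = N)) \<longleftrightarrow> (\<exists>v. w = replicate t N @ v)"
  proof
    assume "t \<le> length w \<and> (\<forall>i<t. w ! i = N)"
    then have "take t w = replicate t N"
      by (intro nth_equalityI) auto
    then show "\<exists>v. w = replicate t N @ v"
      by (metis append_take_drop_id)
  qed (auto simp: nth_append)
  show ?thesis
    unfolding schroeder_path_def using * assms by auto
qed

text \<open>The initial N steps raise the level to \<open>m * t\<close>; of the height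
  \<open>n\<close> they use \<open>t\<close> and the D steps use \<open>a\<close>, which leaves
  \<open>n - t - a\<close> further N steps.\<close>

lemma positive_paths_eq:
  assumes m: "m > 0" and t: "t > 0" and a: "t \<le> n" "a \<le> n - t"
  shows "positive_paths m t n a b =
      (\<lambda>v. replicate t N @ v) ` descents (\<lambda>_. True) m (m * t) (n - t - a) a b"
    and "{w \<in> positive_paths m t n a b. m_divisible m w} =
      (\<lambda>v. replicate t N @ v) ` descents ((dvd) m) m (m * t) (n - t - a) a b"
proof -
  have D: "descends Q m m (replicate (t - 1) N @ v) = descends Q m (m * t) v" for Q v
    using descends_replicate[OF m, of Q 0 "t - 1" v] t by simp
  have C: "corners m m (replicate (t - 1) N @ v) = corners m (m * t) v" for v
    using corners_replicate[of m 1 "t - 1" v] t by simp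
  have R: "replicate t N @ v = N # (replicate (t - 1) N @ v)" for v
    using t by (cases t) auto
  have count: "count_list (replicate j N) N = j" "count_list (replicate j N) D = 0" for j
    by (induction j) auto
  have pos: "replicate t N @ v \<in> positive_paths m t n a b \<longleftrightarrow>
      v \<in> descents (\<lambda>_. True) m (m * t) (n - t - a) a b" for v
  proof -
    let ?u = "replicate (t - 1) N @ v"
    have "replicate t N @ v \<in> positive_paths m t n a b \<longleftrightarrow>
        descends (\<lambda>_. True) m m ?u \<and> Suc (count_list ?u N + count_list ?u D) = n \<and>
        count_list ?u D = a \<and> corners m m ?u = b"
      unfolding positive_paths_def mem_Collect_eq schroeder_path_replicate_iff[OF t]
      unfolding R
      using positive_Cons_iff[OF m, of n ?u] cornered_steps_card[OF m, of "\<lambda>_. True" ?u n]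
      by (auto simp: diagonal_steps_card)
    then show ?thesis
      using a t unfolding descents_def D C by (auto simp: count)
  qed
  have ex: "\<exists>v. w = replicate t N @ v" if "w \<in> positive_paths m t n a b" for w
    using that schroeder_path_replicate_iff[OF t] unfolding positive_paths_def by auto
  have div: "m_divisible m (replicate t N @ v) \<longleftrightarrow> descends ((dvd) m) m (m * t) v"
    if "v \<in> descents (\<lambda>_. True) m (m * t) (n - t - a) a b" for v
    unfolding R D[symmetric] using that
    by (intro m_divisible_Cons_iff) (simp only: D descents_def mem_Collect_eq)
  show "positive_paths m t n a b =
      (\<lambda>v. replicate t N @ v) ` descents (\<lambda>_. True) m (m * t) (n - t - a) a b"
    using pos ex by blast
  have "v \<in> descents ((dvd) m) m (m * t) (n - t - a) a b \<longleftrightarrow>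
      v \<in> descents (\<lambda>_. True) m (m * t) (n - t - a) a b \<and> descends ((dvd) m) m (m * t) v" for v
    unfolding descents_def using descends_True_and[of "(dvd) m"] by auto
  then show "{w \<in> positive_paths m t n a b. m_divisible m w} =
      (\<lambda>v. replicate t N @ v) ` descents ((dvd) m) m (m * t) (n - t - a) a b"
    using pos ex div by blast
qed

section \<open>First-step recursion for descents\<close>

lemma descends_length:
  "descends Q m h w \<Longrightarrow> m > 0 \<Longrightarrow>
    length w = h + (m + 1) * count_list w N + m * count_list w D"
proof (induction w arbitrary: h)
  case (Cons s w)
  then have "length w = move m h s + (m + 1) * count_list w N + m * count_list w D" "0 < h"
    by auto
  then show ?case
    using \<open>m > 0\<close> by (cases s) auto
qed simp

text \<open>The total drop \<open>h\<close> forces h + m p + (m - 1) a steps E, so all these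
  descents have the same length.\<close>

lemma finite_descents:
  assumes "m > 0"
  shows "finite (descents Q m h p a b)"
proof (rule finite_subset)
  have "set w \<subseteq> {N, E, D}" for w
    using step.exhaust by blast
  then show "descents Q m h p a b \<subseteq>
      {w. set w \<subseteq> {N, E, D} \<and> length w = h + (m + 1) * p + m * a}"
    using assms by (auto simp only: descents_def descends_length)
qed (rule finite_lists_length_eq, simp)

lemma descents_0: "descents Q m 0 p a b = (if p = 0 \<and> a = 0 \<and> b = 0 then {[]} else {})"
proof -
  have *: "descends Q m 0 w \<longleftrightarrow> w = []" for w
    by (cases w) simp_all
  show ?thesis
    unfolding descents_def * by auto
qed

text \<open>Splits by the first step. For \<open>h = 0\<close> the path stands at level 1, where a D
  step is cornered and lowers the remaining \<open>b\<close>.\<close>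

lemma descents_Suc:
  "descents Q m (Suc h) p a b =
     (#) N ` (if p = 0 then {} else descents Q m (Suc h + m) (p - 1) a b) \<union>
     (#) E ` descents Q m h p a b \<union>
     (#) D ` (if Q h \<and> a > 0 \<and> (h = 0 \<longrightarrow> b > 0)
        then descents Q m (h + m) p (a - 1) (if h = 0 then b - 1 else b) else {})"
  (is "_ = ?R")
proof (rule set_eqI)
  fix w
  show "w \<in> descents Q m (Suc h) p a b \<longleftrightarrow> w \<in> ?R"
  proof (cases w)
    case Nil
    then show ?thesis by (auto simp: descents_def)
  next
    case (Cons s v)
    then show ?thesis
      by (cases s) (auto simp: descents_def image_iff)
  qed
qed

lemma card_descents_Suc:
  assumes "m > 0"
  shows "card (descents Q m (Suc h) p a b) =
     (if p = 0 then 0 else card (descents Q m (Suc h + m) (p - 1) a b)) +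
     card (descents Q m h p a b) +
     (if Q h \<and> a > 0 \<and> (h = 0 \<longrightarrow> b > 0)
        then card (descents Q m (h + m) p (a - 1) (if h = 0 then b - 1 else b)) else 0)"
proof -
  have card_Un: "card ((#) N ` X \<union> (#) E ` Y \<union> (#) D ` Z) = card X + card Y + card Z"
    if "finite X" "finite Y" "finite Z" for X Y Z :: "path set"
  proof -
    have "((#) N ` X \<union> (#) E ` Y) \<inter> (#) D ` Z = {}" "(#) N ` X \<inter> (#) E ` Y = {}"
      by auto
    with that show ?thesis
      by (simp add: card_Un_disjoint card_image)
  qed
  show ?thesis
    unfolding descents_Suc by (subst card_Un) (auto simp: finite_descents[OF assms])
qed

section \<open>Binomial identities\<close>

definition corner_binomial :: "nat \<Rightarrow> nat \<Rightarrow> nat \<Rightarrow> real" where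
  "corner_binomial l a b = (if b \<le> a then real ((l - b - 1) choose (a - b)) else 0)"

text \<open>By absorption this is (a - b) / (l - b - 1) times \<open>corner_binomial\<close>, stated
  without division; the default 0 at \<open>a = b\<close> matches the convention for the fraction in
  the theorem. In both definitions the default replaces the value 1 that truncated subtraction could
  produce.\<close>

definition corner_binomial' :: "nat \<Rightarrow> nat \<Rightarrow> nat \<Rightarrow> real" where
  "corner_binomial' l a b = (if b < a then real ((l - b - 2) choose (a - b - 1)) else 0)"

text \<open>Pascal's rule: \<open>a < l\<close> prevents truncation of the upper index, and at
  \<open>a = b\<close> the second summand is the default 0.\<close>

lemma corner_binomial_pascal:
  assumes "a < l"
  shows "corner_binomial (Suc l) a b =
    corner_binomial l a b + (if a > 0 then corner_binomial l (a - 1) b else 0)"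
proof (cases "b < a")
  case True
  then obtain i j where "a = Suc (b + i)" "l = Suc (b + j)"
    using assms less_imp_Suc_add by (metis less_trans)
  then show ?thesis
    by (simp add: corner_binomial_def Suc_diff_le)
qed (use assms in \<open>auto simp: corner_binomial_def\<close>)

lemma corner_binomial'_pascal:
  assumes "a < l"
  shows "corner_binomial' (Suc l) a b =
    corner_binomial' l a b + (if a > 0 then corner_binomial' l (a - 1) b else 0)"
proof (cases "Suc b < a")
  case True
  then obtain i j where "a = Suc (Suc (b + i))" "l = Suc (Suc (b + j))"
    using assms by (metis add_Suc less_imp_Suc_add less_trans)
  then show ?thesis
    by (simp add: corner_binomial'_def)
qed (use assms in \<open>auto simp: corner_binomial'_def\<close>)

lemma corner_binomial_shift:
  "corner_binomial (Suc l) (Suc a) (Suc b) = corner_binomial l a b"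
  "corner_binomial' (Suc l) (Suc a) (Suc b) = corner_binomial' l a b"
  by (simp_all add: corner_binomial_def corner_binomial'_def)

text \<open>Pascal's rule holds for (l + p choose p), and also after multiplication by p / (l + 1),
  which turns it into (l + p choose p - 1). The claim is a linear combination of the two, with
  \<open>x\<close> and \<open>y\<close> held constant.\<close>

lemma ballot_step:
  fixes x y :: real
  assumes "l > 0"
  shows "((real (Suc l) - real m * real p) / real (Suc l) * x - y) * real ((l + p) choose p) =
    (if p = 0 then 0 else
      ((real (Suc l) - real m * real (p - 1)) / real (Suc l) * x - y) *
        real ((l + (p - 1)) choose (p - 1))) +
    ((real l - real m * real p) / real l * x - y) * real ((l + p - 1) choose p)"
proof (cases p)
  case 0
  then show ?thesis using assms by simp
next
  case (Suc q)
  \<comment> \<open>The binomials \<open>u\<close> and \<open>v\<close> are proportional, which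
    reduces the claim to an identity of rational functions.\<close>
  define u where "u = real ((l + q) choose q)"
  define v where "v = real ((l + q) choose Suc q)"
  have "Suc q * (Suc (l + q) choose Suc q) = Suc (l + q) * ((l + q) choose q)"
    by (rule Suc_times_binomial)
  then have "real (Suc q * (Suc (l + q) choose Suc q)) = real (Suc (l + q) * ((l + q) choose q))"
    by (rule arg_cong)
  then have "real (Suc q) * (u + v) = real (Suc (l + q)) * u"
    by (simp only: u_def v_def of_nat_mult of_nat_add binomial_Suc_Suc)
  then have v: "v = real l * u / (1 + real q)"
    by (simp add: field_simps)
  have "((real l + 1 - real m * (real q + 1)) / (real l + 1) * x - y) * (u + v) =
     ((real l + 1 - real m * real q) / (real l + 1) * x - y) * u +
     ((real l - real m * (real q + 1)) / real l * x - y) * v"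
    unfolding v using assms by (simp add: divide_simps) algebra
  then show ?thesis
    unfolding Suc by (simp add: u_def v_def algebra_simps)
qed

section \<open>Closed form for a periodic set of diagonal levels\<close>

locale periodic_steps =
  fixes Q :: "nat \<Rightarrow> bool" and m :: nat
  assumes m_pos: "m > 0" and Q_0: "Q 0" and Q_add: "Q (j + m) = Q j"
begin

text \<open>Counts the levels from 1 to \<open>l\<close> at which D is allowed, since
  \<open>Q j\<close> governs level j + 1. By periodicity \<open>slots m\<close> is the number per
  period, and it is the only trace of \<open>Q\<close> in the final formula.\<close>

definition slots :: "nat \<Rightarrow> nat" where
  "slots l = card {j. j < l \<and> Q j}"

lemma slots_0 [simp]: "slots 0 = 0"
  by (simp add: slots_def)

lemma slots_Suc: "slots (Suc l) = slots l + of_bool (Q l)"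
  by (simp add: slots_def card_less_eq_sum)

lemma slots_add: "slots (l + m) = slots l + slots m"
proof (induction l)
  case (Suc l)
  then show ?case by (simp add: slots_Suc Q_add)
qed simp

lemma slots_mult: "slots (m * j) = slots m * j"
proof (induction j)
  case (Suc j)
  then show ?case
    using slots_add[of "m * j"] by (simp add: add.commute)
qed simp

lemma slots_mono: "l \<le> l' \<Longrightarrow> slots l \<le> slots l'"
  by (auto simp: slots_def intro: card_mono)

lemma slots_m_pos: "slots m > 0"
  using slots_mono[of "Suc 0" m] m_pos Q_0 by (simp add: slots_Suc)

lemma Q_add_mult: "Q (h + m * j) = Q h"
proof (induction j)
  case (Suc j)
  then show ?case
    using Q_add[of "h + m * j"] by (simp add: algebra_simps)
qed simp

text \<open>Each of the \<open>j\<close> periods contains a slot, and \<open>Q (m * j)\<close>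
  supplies one more. This gives the hypothesis of the Pascal rules for the corner binomials.\<close>

lemma less_slots: "j < slots (Suc h + m * j)"
proof -
  have "j \<le> slots (m * j)"
    using slots_m_pos by (simp add: slots_mult)
  also have "\<dots> < slots (Suc (m * j))"
    using Q_0 Q_add_mult[of 0 j] by (simp add: slots_Suc)
  also have "\<dots> \<le> slots (Suc h + m * j)"
    by (rule slots_mono) simp
  finally show ?thesis .
qed

text \<open>The closed form, parametrised by \<open>l = h + m (p + a)\<close>, the number of E and D steps of a
  descent from level \<open>h\<close> with \<open>p\<close> N steps and \<open>a\<close> D steps; at most \<open>slots l\<close> of these can be D.\<close>

definition weight :: "nat \<Rightarrow> nat \<Rightarrow> nat \<Rightarrow> nat \<Rightarrow> real" where
  "weight l p a b =
     ((real l - real m * real p) / real l * corner_binomial (slots l) a b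
       - real (slots m) * corner_binomial' (slots l) a b) * real ((l + p - 1) choose p)"

text \<open>Splits off an initial N step. The last summand would be \<open>weight l p a b\<close>
  but for \<open>slots (Suc l)\<close> in place of \<open>slots l\<close>; the next two lemmas
  resolve this difference above level 1 and at level 1.\<close>

lemma weight_Suc:
  assumes "l > 0"
  shows "weight (Suc l) p a b = (if p = 0 then 0 else weight (Suc l) (p - 1) a b) +
    ((real l - real m * real p) / real l * corner_binomial (slots (Suc l)) a b
       - real (slots m) * corner_binomial' (slots (Suc l)) a b) * real ((l + p - 1) choose p)"
  using ballot_step[OF assms, of m p "corner_binomial (slots (Suc l)) a b"
      "real (slots m) * corner_binomial' (slots (Suc l)) a b"]
  by (simp add: weight_def)

text \<open>The recursion at level \<open>Suc (Suc h)\<close>. An N step keeps the number of E and D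
  steps and lowers \<open>p\<close>; an E or D step lowers that number by one. By periodicity D is
  allowed here exactly if \<open>slots\<close> grows from \<open>l\<close> to \<open>Suc l\<close>,
  and then Pascal's rule yields the D term.\<close>

lemma weight_step:
  fixes h p a :: nat
  defines "l \<equiv> Suc h + m * (p + a)"
  shows "weight (Suc l) p a b = (if p = 0 then 0 else weight (Suc l) (p - 1) a b) +
    weight l p a b + (if Q (Suc h) \<and> a > 0 then weight l p (a - 1) b else 0)"
proof -
  have l: "l > 0" and Q: "Q l = Q (Suc h)"
    unfolding l_def by (simp, rule Q_add_mult)
  have a: "a < slots l"
    unfolding l_def using less_slots[of "p + a" h] by simp
  \<comment> \<open>Linearity of \<open>weight\<close> in the two corner binomials, in the syntactic
    shape needed for rewriting.\<close>
  have distrib: "(r * (x + x') / q - k * (y + y')) * c =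
      (r * x / q - k * y) * c + (r * x' / q - k * y') * c" for r x x' q k y y' c :: real
    by (simp add: algebra_simps add_divide_distrib)
  show ?thesis
  proof (cases "Q (Suc h)")
    case False
    then show ?thesis
      by (subst weight_Suc[OF l]) (simp add: weight_def slots_Suc Q)
  next
    case True
    then show ?thesis
      by (subst weight_Suc[OF l])
        (simp add: weight_def slots_Suc Q distrib
          corner_binomial_pascal[OF a] corner_binomial'_pascal[OF a])
  qed
qed

text \<open>The recursion at level 1. There is no E term, because E would reach level 0 while N or D
  steps remain.\<close>

lemma weight_corner_step:
  fixes p a :: nat
  defines "l \<equiv> m * (p + a)"
  assumes "p + a > 0"
  shows "weight (Suc l) p a b = (if p = 0 then 0 else weight (Suc l) (p - 1) a b) +
    (if a > 0 \<and> b > 0 then weight l p (a - 1) (b - 1) else 0)"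
proof -
  have l: "l > 0"
    using assms m_pos by (simp add: l_def)
  have Sl: "slots (Suc l) = Suc (slots l)"
    using Q_add_mult[of 0 "p + a"] Q_0 by (simp add: slots_Suc l_def)
  have "((real l - real m * real p) / real l * corner_binomial (Suc (slots l)) a b
       - real (slots m) * corner_binomial' (Suc (slots l)) a b) * real ((l + p - 1) choose p) =
    (if a > 0 \<and> b > 0 then weight l p (a - 1) (b - 1) else 0)"
  proof (cases "a > 0")
    \<comment> \<open>Here \<open>l = m * p\<close>, so the factor
      \<open>real l - real m * real p\<close> vanishes.\<close>
    case False
    then show ?thesis
      using l by (cases "b = 0")
        (auto simp: corner_binomial_def corner_binomial'_def l_def)
  next
    case a: True
    show ?thesis
    proof (cases "b > 0")
      case True
      with a show ?thesis
        using corner_binomial_shift[of "slots l" "a - 1" "b - 1"] by (simp add: weight_def)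
    next
      case False
      \<comment> \<open>With \<open>b = 0\<close> a D step from level 1 is excluded, so the two
        terms must cancel. They do by the absorption identity for L =
        \<open>slots m * (p + a)\<close>: a (L choose a) = L (L - 1 choose a - 1).\<close>
      define B where "B = real (slots l choose a)"
      define C where "C = real ((slots l - 1) choose (a - 1))"
      have "slots l = slots m * (p + a)"
        by (simp add: l_def slots_mult)
      then have "real a * B = real (slots m) * real (p + a) * C"
        using times_binomial_minus1_eq[OF a, of "slots l"]
        unfolding B_def C_def of_nat_mult[symmetric] by simp
      moreover have "real l - real m * real p = real m * real a" "real l = real m * real (p + a)"
        by (simp_all add: l_def algebra_simps)
      ultimately have "(real l - real m * real p) / real l * B = real (slots m) * C"
        using m_pos a by (simp add: divide_simps)
      then show ?thesis
        using False a by (simp add: corner_binomial_def corner_binomial'_def B_def C_def)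
    qed
  qed
  then show ?thesis
    by (subst weight_Suc[OF l]) (simp add: Sl)
qed

lemma card_descents:
  "real (card (descents Q m (Suc h) p a b)) = weight (Suc h + m * (p + a)) p a b"
\<comment> \<open>N and D steps may raise the level, so the induction is on the steps left: N lowers
  \<open>p\<close> and keeps the number of E and D steps, while E and D lower that number and keep
  \<open>p\<close>.\<close>
proof (induction "2 * (Suc h + m * (p + a)) + p" arbitrary: h p a b rule: less_induct)
  case less
  define l where "l = h + m * (p + a)"
  have N: "real (card (descents Q m (Suc h + m) (p - 1) a b)) = weight (Suc l) (p - 1) a b"
    if "p > 0"
    using less[of "h + m" "p - 1" a b] that
    by (cases p) (simp_all add: l_def algebra_simps)
  show ?case
  proof (cases h)
    case (Suc h')
    have E: "real (card (descents Q m h p a b)) = weight l p a b"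
      using less[of h' p a b] by (simp add: l_def Suc)
    have D: "real (card (descents Q m (h + m) p (a - 1) b)) = weight l p (a - 1) b" if "a > 0"
      using less[of "h' + m" p "a - 1" b] that
      by (cases a) (simp_all add: l_def Suc algebra_simps)
    show ?thesis
      using weight_step[where h = h' and p = p and a = a and b = b] N E D
      unfolding card_descents_Suc[OF m_pos] by (auto simp: Suc l_def)
  next
    case 0
    show ?thesis
    proof (cases "p + a > 0")
      case True
      then have E: "card (descents Q m h p a b) = 0"
        by (auto simp: 0 descents_0)
      have D: "real (card (descents Q m (h + m) p (a - 1) (b - 1))) = weight l p (a - 1) (b - 1)"
        if "a > 0"
        using less[of "m - 1" p "a - 1" "b - 1"] that m_pos
        by (cases a) (simp_all add: l_def 0 algebra_simps)
      show ?thesis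
        using weight_corner_step[OF True, of b] N E D Q_0
        unfolding card_descents_Suc[OF m_pos] by (auto simp: 0 l_def)
    next
      \<comment> \<open>Only the single E step from level 1 to level 0 remains.\<close>
      case False
      then show ?thesis
        unfolding card_descents_Suc[OF m_pos]
        by (auto simp: 0 descents_0 weight_def corner_binomial_def corner_binomial'_def)
    qed
  qed
qed

text \<open>At \<open>l = m * n\<close> there are \<open>slots m * n\<close> slots; absorption turns
  \<open>corner_binomial'\<close> back into the fraction, whose denominator is positive when
  \<open>b < a\<close>.\<close>

lemma weight_eq:
  assumes "t \<le> n" "b \<le> a" "a \<le> n - t" "t > 0"
  shows "weight (m * n) (n - t - a) a b =
    ((real t + real a) / real n
        - real (slots m) * (real a - real b) / (real (slots m) * real n - real b - 1))
      * real ((slots m * n - b - 1) choose (a - b))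
      * real ((m * n + n - t - a - 1) choose (n - t - a))"
proof -
  let ?k = "slots m"
  have "n \<le> ?k * n"
    using slots_m_pos by simp
  then have le: "b + 1 \<le> ?k * n" "b < a \<Longrightarrow> b + 1 < ?k * n"
    using assms by linarith+
  define d where "d = real ?k * real n - real b - 1"
  have d: "real (?k * n - b - 1) = d"
    using le(1) by (simp add: of_nat_diff d_def)
  have "corner_binomial' (?k * n) a b =
      (real a - real b) / (real ?k * real n - real b - 1) * real ((?k * n - b - 1) choose (a - b))"
  proof (cases "b < a")
    case True
    then have "real (a - b) * real ((?k * n - b - 1) choose (a - b)) =
        real (?k * n - b - 1) * corner_binomial' (?k * n) a b"
      using times_binomial_minus1_eq[of "a - b" "?k * n - b - 1"]
      unfolding of_nat_mult[symmetric] corner_binomial'_def by (simp add: numeral_2_eq_2)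
    moreover have "real (?k * n - b - 1) > 0"
      unfolding of_nat_0_less_iff using le(2)[OF True] by simp
    ultimately show ?thesis
      using True unfolding d d_def[symmetric] by (simp add: eq_divide_eq mult.commute of_nat_diff)
  qed (use assms in \<open>simp add: corner_binomial'_def\<close>)
  moreover have "(real (m * n) - real m * real (n - t - a)) / real (m * n) =
      (real t + real a) / real n"
    using assms m_pos by (simp add: of_nat_diff field_simps)
  moreover have "m * n + (n - t - a) - 1 = m * n + n - t - a - 1"
    using assms by simp
  ultimately show ?thesis
    using assms unfolding weight_def slots_mult by (simp add: corner_binomial_def algebra_simps)
qed

lemma card_descents_eq:
  assumes "t \<le> n" "b \<le> a" "a \<le> n - t" "t > 0"
  shows "real (card (descents Q m (m * t) (n - t - a) a b)) =
    ((real t + real a) / real n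
        - real (slots m) * (real a - real b) / (real (slots m) * real n - real b - 1))
      * real ((slots m * n - b - 1) choose (a - b))
      * real ((m * n + n - t - a - 1) choose (n - t - a))"
proof -
  have "Suc (m * t - 1) = m * t"
    using m_pos assms(4) by simp
  moreover have "m * t + m * (n - t - a + a) = m * n"
    using assms by (simp flip: add_mult_distrib2)
  ultimately show ?thesis
    using card_descents[of "m * t - 1" "n - t - a" a b] weight_eq[OF assms] by simp
qed

end

theorem theorem1p4:
  fixes m n t a b :: nat
  assumes "m > 0" and "n > 0" and "t > 0" and "t \<le> n"
    and "b \<le> a" and "a \<le> n - t"
  shows
    "real (card (positive_paths m t n a b)) =
       ((real t + real a) / real n
          - real m * (real a - real b) / (real m * real n - real b - 1))
       * real ((m * n - b - 1) choose (a - b))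
       * real ((m * n + n - t - a - 1) choose (n - t - a))
     \<and>
     real (card {w \<in> positive_paths m t n a b. m_divisible m w}) =
       ((real t + real a) / real n
          - (real a - real b) / (real n - real b - 1))
       * real ((n - b - 1) choose (a - b))
       * real ((m * n + n - t - a - 1) choose (n - t - a))"
proof -
  interpret all: periodic_steps "\<lambda>_. True" m
    using assms(1) by unfold_locales auto
  interpret dvd: periodic_steps "(dvd) m" m
    using assms(1) by unfold_locales auto
  \<comment> \<open>A period contains one multiple of \<open>m\<close>, so \<open>slots m\<close> is
    1 under divisibility and \<open>m\<close> without restriction.\<close>
  have "{j. j < m \<and> m dvd j} = {0}"
    using assms(1) by (auto dest: nat_dvd_not_less)
  then have "dvd.slots m = 1" "all.slots m = m"
    by (simp_all add: dvd.slots_def all.slots_def)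
  moreover have "card ((\<lambda>v. replicate t N @ v) ` A) = card A" for A
    by (rule card_image) (simp add: inj_on_def)
  then have "card (positive_paths m t n a b) =
        card (descents (\<lambda>_. True) m (m * t) (n - t - a) a b)"
    and "card {w \<in> positive_paths m t n a b. m_divisible m w} =
        card (descents ((dvd) m) m (m * t) (n - t - a) a b)"
    using positive_paths_eq[OF assms(1,3,4,6), of b] by simp_all
  ultimately show ?thesis
    using all.card_descents_eq[of t n b a] dvd.card_descents_eq[of t n b a] assms by simp
qed

end
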